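(* Let $\mathcal{I}$ and $\mathcal{K}$ be two ideals on a set $S$ such that the condition $\mathrm{AP}(\mathcal{I},\mathcal{K})$ holds. Let $X$ be a metric space. Then for any function $f\colon S\to X$, if $f$ is $\mathcal{I}$-divergent then $f$ is $\mathcal{I}^{\mathcal{K}}$-divergent.
   Context: An ideal on a set $S$ is a nonempty family of subsets of $S$ closed under subsets and finite unions (not required to be proper). Its dual filter is $\mathcal{F}(\mathcal{I})=\{S\setminus A: A\in\mathcal{I}\}$. For $M\subseteq S$, $\mathcal{K}|_M=\{A\cap M: A\in\mathcal{K}\}$ is the trace ideal on $M$. Let $(X,d)$ be a metric space. A function $f\colon S\to X$ is $\mathcal{I}$-divergent if there is $x\in X$ such that for every $r>0$, $\{k\in S: d(f(k),x)\le r\}\in\mathcal{I}$. It is $\mathcal{I}^{\mathcal{K}}$-divergent if there is $M\in\mathcal{F}(\mathcal{I})$ such that $f|_M\colon M\to X$ is $\mathcal{K}|_M$-divergent. Condition $\mathrm{AP}(\mathcal{I},\mathcal{K})$ (additive property of $\mathcal{I}$ with respect to $\mathcal{K}$): for every sequence $(A_n)_{n\in\mathbb{N}}$ of pairwise disjoint sets $A_n\in\mathcal{I}$ there exists a sequence $(B_n)_{n\in\mathbb{N}}$ of sets $B_n\in\mathcal{I}$ such that $A_n\triangle B_n\in\mathcal{K}$ for each $n$ and $\bigcup_{n\in\mathbb{N}}B_n\in\mathcal{I}$. *)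

theory Defs
  imports "HOL-Analysis.Analysis"
begin

text \<open>Ideals on a set \<open>S\<close> need not be proper: \<open>S \<in> I\<close> is allowed.\<close>

definition ideal_on :: "'a set \<Rightarrow> 'a set set \<Rightarrow> bool" where
  "ideal_on S I \<longleftrightarrow>
     I \<subseteq> Pow S \<and> I \<noteq> {} \<and>
     (\<forall>A\<in>I. \<forall>B. B \<subseteq> A \<longrightarrow> B \<in> I) \<and>
     (\<forall>A\<in>I. \<forall>B\<in>I. A \<union> B \<in> I)"

definition dual_filter :: "'a set \<Rightarrow> 'a set set \<Rightarrow> 'a set set" where
  "dual_filter S I = {S - A |A. A \<in> I}"

definition trace_ideal :: "'a set set \<Rightarrow> 'a set \<Rightarrow> 'a set set" where
  "trace_ideal K M = {A \<inter> M |A. A \<in> K}"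

text \<open>The metric space is given by its carrier \<open>X\<close> and distance \<open>d\<close>; the predicates below are
  meant for functions \<open>f \<in> S \<rightarrow> X\<close>, and ignore the values of \<open>f\<close> outside \<open>S\<close>.\<close>

definition ideal_divergent ::
  "'a set \<Rightarrow> 'a set set \<Rightarrow> 'b set \<Rightarrow> ('b \<Rightarrow> 'b \<Rightarrow> real) \<Rightarrow> ('a \<Rightarrow> 'b) \<Rightarrow> bool" where
  "ideal_divergent S I X d f \<longleftrightarrow> (\<exists>x\<in>X. \<forall>r>0. {k\<in>S. d (f k) x \<le> r} \<in> I)"

definition ideal_star_divergent ::
  "'a set \<Rightarrow> 'a set set \<Rightarrow> 'a set set \<Rightarrow> 'b set \<Rightarrow> ('b \<Rightarrow> 'b \<Rightarrow> real) \<Rightarrow> ('a \<Rightarrow> 'b) \<Rightarrow> bool" where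
  "ideal_star_divergent S I K X d f \<longleftrightarrow>
     (\<exists>M \<in> dual_filter S I. ideal_divergent M (trace_ideal K M) X d (restrict f M))"

definition AP :: "'a set set \<Rightarrow> 'a set set \<Rightarrow> bool" where
  "AP I K \<longleftrightarrow>
     (\<forall>A :: nat \<Rightarrow> 'a set. range A \<subseteq> I \<and> disjoint_family A \<longrightarrow>
        (\<exists>B :: nat \<Rightarrow> 'a set. range B \<subseteq> I \<and>
           (\<forall>n. sym_diff (A n) (B n) \<in> K) \<and> (\<Union>n. B n) \<in> I))"

end

theory Submission
  imports Defs
begin

text \<open>
  Let \<open>x\<close> be a point all of whose closed balls have preimages in \<open>I\<close>. Cut \<open>S\<close> into the shells
  \<open>A n\<close> on which the distance of \<open>f k\<close> to \<open>x\<close> has integer part \<open>n\<close>. Each shell lies in the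
  preimage of the ball of radius \<open>n + 1\<close>, so the shells are pairwise disjoint members of \<open>I\<close>, and
  the additive property replaces each \<open>A n\<close> by some \<open>B n\<close> equal to it up to \<open>K\<close>, with
  \<open>U = (\<Union>n. B n)\<close> in \<open>I\<close>. Outside \<open>U\<close> every shell survives only in \<open>A n - B n\<close>, a member of \<open>K\<close>.
  Since a ball of radius \<open>r\<close> meets only the finitely many shells with \<open>n \<le> \<lfloor>r\<rfloor>\<close>, its preimage
  in \<open>M = S - U\<close> is covered by finitely many members of \<open>K\<close>. Hence \<open>M\<close> and the same point \<open>x\<close>
  witness the conclusion.
\<close>

lemma ideal_on_subset: "ideal_on S I \<Longrightarrow> A \<in> I \<Longrightarrow> B \<subseteq> A \<Longrightarrow> B \<in> I"
  unfolding ideal_on_def by blast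

lemma ideal_on_finite_UN:
  assumes I: "ideal_on S I" and "finite N" and "\<And>n. n \<in> N \<Longrightarrow> A n \<in> I"
  shows "(\<Union>n\<in>N. A n) \<in> I"
  using assms(2,3)
proof (induction N rule: finite_induct)
  case empty
  show ?case using I unfolding ideal_on_def by auto
next
  case (insert n N)
  then show ?case using I unfolding ideal_on_def by simp
qed

theorem theorem6p8:
  fixes S :: "'a set" and I K :: "'a set set"
    and X :: "'b set" and d :: "'b \<Rightarrow> 'b \<Rightarrow> real" and f :: "'a \<Rightarrow> 'b"
  assumes "ideal_on S I" and "ideal_on S K"
    and "AP I K"
    and "Metric_space X d"
    and "f \<in> S \<rightarrow> X"
    and "ideal_divergent S I X d f"
  shows "ideal_star_divergent S I K X d f"
proof -
  obtain x where "x \<in> X" and ball: "\<And>r. r > 0 \<Longrightarrow> {k\<in>S. d (f k) x \<le> r} \<in> I"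
    using assms(6) unfolding ideal_divergent_def by blast
  define A where "A n = {k\<in>S. nat \<lfloor>d (f k) x\<rfloor> = n}" for n
  have "A n \<in> I" for n
  proof (rule ideal_on_subset[OF assms(1) ball])
    show "A n \<subseteq> {k\<in>S. d (f k) x \<le> real n + 1}"
      unfolding A_def by (auto; linarith)
  qed simp
  moreover have "disjoint_family A"
    unfolding A_def disjoint_family_on_def by auto
  ultimately obtain B where AB: "\<And>n. sym_diff (A n) (B n) \<in> K" and U: "(\<Union>n. B n) \<in> I"
    using assms(3) unfolding AP_def by (metis image_subsetI)
  define M where "M = S - (\<Union>n. B n)"
  have "M \<in> dual_filter S I"
    using U unfolding dual_filter_def M_def by blast
  moreover have "{k\<in>M. d (restrict f M k) x \<le> r} \<in> trace_ideal K M" for r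
  proof -
    let ?D = "{k\<in>M. d (f k) x \<le> r}"
    have "?D \<subseteq> (\<Union>n\<in>{..nat \<lfloor>r\<rfloor>}. sym_diff (A n) (B n))"
      unfolding A_def M_def by (auto intro: nat_mono floor_mono)
    moreover have "(\<Union>n\<in>{..nat \<lfloor>r\<rfloor>}. sym_diff (A n) (B n)) \<in> K"
      using AB by (intro ideal_on_finite_UN[OF assms(2)]) auto
    ultimately have "?D \<in> K"
      using ideal_on_subset[OF assms(2)] by blast
    moreover have "{k\<in>M. d (restrict f M k) x \<le> r} = ?D \<inter> M"
      by auto
    ultimately show ?thesis
      unfolding trace_ideal_def by blast
  qed
  ultimately show ?thesis
    using \<open>x \<in> X\<close> unfolding ideal_star_divergent_def ideal_divergent_def by blast
qed

end
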